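(* Let $f:\mathbb{R}^{d_x}\to\mathbb{R}$ be convex and $L_f$-smooth for some $L_f>0$, let $g:\mathbb{R}^{d_x}\to\mathbb{R}\cup\{+\infty\}$ be proper, closed and $\mu_g$-strongly convex for some $\mu_g>0$, let $h:\mathbb{R}^{d_y}\to\mathbb{R}\cup\{+\infty\}$ be proper, closed and convex with convex conjugate $h^*$ being $\mu_{h^*}$-strongly convex for some $\mu_{h^*}>0$, and let $\mathsf{K}:\mathbb{R}^{d_x}\to\mathbb{R}^{d_y}$ be a nonzero linear operator with operator norm $\|\mathsf{K}\|$. Let $(x^\star,y^\star,z^\star)$ satisfy $$0\in\partial g(x^\star)+\mathsf{K}^*y^\star+\nabla f(z^\star),\qquad 0\in\partial h^*(y^\star)-\mathsf{K}x^\star,\qquad z^\star=x^\star.$$ Then $(x^\star,y^\star,z^\star)$ is the unique triple satisfying these conditions. Moreover, let $$\eta_x=\min\left\{\frac1{\sqrt{L_f\mu_g}},\sqrt{\frac{\mu_{h^*}}{\|\mathsf{K}\|^2\mu_g}}\right\},\quad\eta_y=\frac12\sqrt{\frac{\mu_g}{\|\mathsf{K}\|^2\mu_{h^*}}},\quad\eta_z=\frac12\sqrt{\frac{\mu_g}{L_f}},$$ let $(x^k,y^k,z^k)_{k\ge0}$ be generated by any one of the four algorithms ACV-I, ACV-II, APDTR-I, APDTR-II with these stepsizes, and define $$\Psi_k=\frac1{2\eta_x}\|x^k-x^\star\|^2+\frac1{2\eta_y}\|y^k-y^\star\|^2+\frac1{\eta_z}D_f(z^k;z^\star)+s_1\langle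 y^k-y^\star,\mathsf{K}(x^k-x^\star)\rangle+s_2\langle\nabla f(z^k)-\nabla f(z^\star),x^k-x^\star\rangle,$$ where $(s_1,s_2)=(-1,-1)$ for ACV-I, $(+1,-1)$ for ACV-II, $(-1,+1)$ for APDTR-I and $(+1,+1)$ for APDTR-II. Then for any $\varepsilon>0$ the number of iterations to achieve $\Psi_k\le\varepsilon\Psi_0$ is $$\mathcal{O}\left(\left(\sqrt{\frac{L_f}{\mu_g}}+\sqrt{\frac{\|\mathsf{K}\|^2}{\mu_g\mu_{h^*}}}\right)\log\frac1\varepsilon\right).$$
   Context: A proper closed function $\phi$ is $\mu$-strongly convex ($\mu\ge0$; $\mu=0$ means convex) if $\phi(x)\ge\phi(y)+\langle p,x-y\rangle+\frac{\mu}{2}\|x-y\|^2$ for all $x,y\in\mathrm{dom}(\phi)$ and all $p\in\partial\phi(y)$. A differentiable $\phi$ is $L$-smooth if $\nabla\phi$ is $L$-Lipschitz. $h^*(y)=\sup_u\{\langle y,u\rangle-h(u)\}$. $D_f(x;y)=f(x)-f(y)-\langle\nabla f(y),x-y\rangle$. $\mathrm{prox}_F(v)=\arg\min_w\{F(w)+\frac12\|w-v\|^2\}$. $\mathsf{K}^*$ is the adjoint of $\mathsf{K}$. The notation $\mathcal{O}(\cdot)$ hides a numerical constant. The underlying problem is $\min_x f(x)+g(x)+h(\mathsf{K}x)$. Each algorithm starts from $x^0,z^0\in\mathbb{R}^{d_x}$, $y^0\in\mathbb{R}^{d_y}$ and, for $k=0,1,2,\dots$, performs in the order listed: ACV-I: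 $x^{k+1}=\mathrm{prox}_{\eta_xg}(x^k-\eta_x\mathsf{K}^*y^k-\eta_x\nabla f(z^k))$; $y^{k+1}=\mathrm{prox}_{\eta_yh^*}(y^k+\eta_y\mathsf{K}(2x^{k+1}-x^k))$; $z^{k+1}=\frac1{1+\eta_z}z^k+\frac{\eta_z}{1+\eta_z}(2x^{k+1}-x^k)$. ACV-II: $y^{k+1}=\mathrm{prox}_{\eta_yh^*}(y^k+\eta_y\mathsf{K}x^k)$; $x^{k+1}=\mathrm{prox}_{\eta_xg}(x^k-\eta_x\mathsf{K}^*(2y^{k+1}-y^k)-\eta_x\nabla f(z^k))$; $z^{k+1}=\frac1{1+\eta_z}z^k+\frac{\eta_z}{1+\eta_z}(2x^{k+1}-x^k)$. APDTR-I: $z^{k+1}=\frac1{1+\eta_z}z^k+\frac{\eta_z}{1+\eta_z}x^k$; $x^{k+1}=\mathrm{prox}_{\eta_xg}(x^k-\eta_x\mathsf{K}^*y^k-\eta_x(2\nabla f(z^{k+1})-\nabla f(z^k)))$; $y^{k+1}=\mathrm{prox}_{\eta_yh^*}(y^k+\eta_y\mathsf{K}(2x^{k+1}-x^k))$. APDTR-II: $y^{k+1}=\mathrm{prox}_{\eta_yh^*}(y^k+\eta_y\mathsf{K}x^k)$; $z^{k+1}=\frac1{1+\eta_z}z^k+\frac{\eta_z}{1+\eta_z}x^k$; $x^{k+1}=\mathrm{prox}_{\eta_xg}(x^k-\eta_x\mathsf{K}^*(2y^{k+1}-y^k)-\eta_x(2\nabla f(z^{k+1})-\nabla f(z^k)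))$.
   Formalization: With κ=√(L_f/μ_g)+√(‖K‖²/(μ_g μ_{h*})), the iteration bound is proved as 3·max{1,κ}·log(1/ε), since no numerical constant works for κ·log(1/ε) as κ→0; for κ≥1 it is the stated bound. *)

theory Defs
  imports "HOL-Analysis.Analysis"
begin

text \<open>
  Extended-real-valued functions have values in \<^typ>\<open>ereal\<close>; the value \<open>-\<infinity>\<close> is excluded by
  properness.
\<close>

definition effective_domain :: "('a \<Rightarrow> ereal) \<Rightarrow> 'a set" where
  "effective_domain \<phi> = {x. \<phi> x < \<infinity>}"

definition extended_epigraph :: "('a \<Rightarrow> ereal) \<Rightarrow> ('a \<times> real) set" where
  "extended_epigraph \<phi> = {(x, r). \<phi> x \<le> ereal r}"

definition proper_fun :: "('a \<Rightarrow> ereal) \<Rightarrow> bool" where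
  "proper_fun \<phi> \<longleftrightarrow> (\<forall>x. \<phi> x \<noteq> -\<infinity>) \<and> effective_domain \<phi> \<noteq> {}"

definition closed_fun :: "('a::topological_space \<Rightarrow> ereal) \<Rightarrow> bool" where
  "closed_fun \<phi> \<longleftrightarrow> closed (extended_epigraph \<phi>)"

definition convex_fun :: "('a::real_vector \<Rightarrow> ereal) \<Rightarrow> bool" where
  "convex_fun \<phi> \<longleftrightarrow> convex (extended_epigraph \<phi>)"

definition subdifferential :: "('a::real_inner \<Rightarrow> ereal) \<Rightarrow> 'a \<Rightarrow> 'a set" where
  "subdifferential \<phi> y =
     {p. \<bar>\<phi> y\<bar> \<noteq> \<infinity> \<and> (\<forall>x. \<phi> x \<ge> \<phi> y + ereal (p \<bullet> (x - y)))}"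

text \<open>
  Convexity is a separate conjunct: with the subdifferential of convex analysis the
  subgradient inequality says nothing at points without subgradients, and for \<open>\<mu> = 0\<close> it holds
  for every function.
\<close>

definition strongly_convex :: "real \<Rightarrow> ('a::real_inner \<Rightarrow> ereal) \<Rightarrow> bool" where
  "strongly_convex \<mu> \<phi> \<longleftrightarrow>
     proper_fun \<phi> \<and> closed_fun \<phi> \<and> convex_fun \<phi> \<and>
     (\<forall>x\<in>effective_domain \<phi>. \<forall>y\<in>effective_domain \<phi>. \<forall>p\<in>subdifferential \<phi> y.
        \<phi> x \<ge> \<phi> y + ereal (p \<bullet> (x - y) + \<mu> / 2 * (norm (x - y))\<^sup>2))"

definition convex_conjugate :: "('a::real_inner \<Rightarrow> ereal) \<Rightarrow> 'a \<Rightarrow> ereal" where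
  "convex_conjugate h y = (SUP u. ereal (y \<bullet> u) - h u)"

definition prox :: "('a::real_inner \<Rightarrow> ereal) \<Rightarrow> 'a \<Rightarrow> 'a" where
  "prox F v = arg_min (\<lambda>w. F w + ereal (1 / 2 * (norm (w - v))\<^sup>2)) (\<lambda>w. True)"

definition gradient :: "('a::real_inner \<Rightarrow> real) \<Rightarrow> 'a \<Rightarrow> 'a" where
  "gradient f x = (THE D. GDERIV f x :> D)"

definition smooth_fun :: "real \<Rightarrow> ('a::real_inner \<Rightarrow> real) \<Rightarrow> bool" where
  "smooth_fun L f \<longleftrightarrow> (\<forall>x. f differentiable (at x)) \<and> L-lipschitz_on UNIV (gradient f)"

definition bregman :: "('a::real_inner \<Rightarrow> real) \<Rightarrow> 'a \<Rightarrow> 'a \<Rightarrow> real" where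
  "bregman f x y = f x - f y - gradient f y \<bullet> (x - y)"

definition optimality_triple ::
  "('a::real_inner \<Rightarrow> real) \<Rightarrow> ('a \<Rightarrow> ereal) \<Rightarrow> ('b::real_inner \<Rightarrow> ereal) \<Rightarrow> ('a \<Rightarrow> 'b) \<Rightarrow>
   'a \<Rightarrow> 'b \<Rightarrow> 'a \<Rightarrow> bool" where
  "optimality_triple f g h K x y z \<longleftrightarrow>
     0 \<in> (\<lambda>p. p + adjoint K y + gradient f z) ` subdifferential g x \<and>
     0 \<in> (\<lambda>q. q - K x) ` subdifferential (convex_conjugate h) y \<and>
     z = x"

datatype scheme = ACV_I | ACV_II | APDTR_I | APDTR_II

fun generated_by ::
  "scheme \<Rightarrow> ('a::real_inner \<Rightarrow> real) \<Rightarrow> ('a \<Rightarrow> ereal) \<Rightarrow> ('b::real_inner \<Rightarrow> ereal) \<Rightarrow>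
   ('a \<Rightarrow> 'b) \<Rightarrow> real \<Rightarrow> real \<Rightarrow> real \<Rightarrow> (nat \<Rightarrow> 'a) \<Rightarrow> (nat \<Rightarrow> 'b) \<Rightarrow> (nat \<Rightarrow> 'a) \<Rightarrow> bool" where
  "generated_by ACV_I f g h K \<eta>x \<eta>y \<eta>z x y z \<longleftrightarrow> (\<forall>k.
     x (Suc k) = prox (\<lambda>w. ereal \<eta>x * g w)
       (x k - \<eta>x *\<^sub>R adjoint K (y k) - \<eta>x *\<^sub>R gradient f (z k)) \<and>
     y (Suc k) = prox (\<lambda>w. ereal \<eta>y * convex_conjugate h w)
       (y k + \<eta>y *\<^sub>R K (2 *\<^sub>R x (Suc k) - x k)) \<and>
     z (Suc k) = (1 / (1 + \<eta>z)) *\<^sub>R z k + (\<eta>z / (1 + \<eta>z)) *\<^sub>R (2 *\<^sub>R x (Suc k) - x k))"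
| "generated_by ACV_II f g h K \<eta>x \<eta>y \<eta>z x y z \<longleftrightarrow> (\<forall>k.
     y (Suc k) = prox (\<lambda>w. ereal \<eta>y * convex_conjugate h w) (y k + \<eta>y *\<^sub>R K (x k)) \<and>
     x (Suc k) = prox (\<lambda>w. ereal \<eta>x * g w)
       (x k - \<eta>x *\<^sub>R adjoint K (2 *\<^sub>R y (Suc k) - y k) - \<eta>x *\<^sub>R gradient f (z k)) \<and>
     z (Suc k) = (1 / (1 + \<eta>z)) *\<^sub>R z k + (\<eta>z / (1 + \<eta>z)) *\<^sub>R (2 *\<^sub>R x (Suc k) - x k))"
| "generated_by APDTR_I f g h K \<eta>x \<eta>y \<eta>z x y z \<longleftrightarrow> (\<forall>k.
     z (Suc k) = (1 / (1 + \<eta>z)) *\<^sub>R z k + (\<eta>z / (1 + \<eta>z)) *\<^sub>R x k \<and>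
     x (Suc k) = prox (\<lambda>w. ereal \<eta>x * g w)
       (x k - \<eta>x *\<^sub>R adjoint K (y k)
         - \<eta>x *\<^sub>R (2 *\<^sub>R gradient f (z (Suc k)) - gradient f (z k))) \<and>
     y (Suc k) = prox (\<lambda>w. ereal \<eta>y * convex_conjugate h w)
       (y k + \<eta>y *\<^sub>R K (2 *\<^sub>R x (Suc k) - x k)))"
| "generated_by APDTR_II f g h K \<eta>x \<eta>y \<eta>z x y z \<longleftrightarrow> (\<forall>k.
     y (Suc k) = prox (\<lambda>w. ereal \<eta>y * convex_conjugate h w) (y k + \<eta>y *\<^sub>R K (x k)) \<and>
     z (Suc k) = (1 / (1 + \<eta>z)) *\<^sub>R z k + (\<eta>z / (1 + \<eta>z)) *\<^sub>R x k \<and>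
     x (Suc k) = prox (\<lambda>w. ereal \<eta>x * g w)
       (x k - \<eta>x *\<^sub>R adjoint K (2 *\<^sub>R y (Suc k) - y k)
         - \<eta>x *\<^sub>R (2 *\<^sub>R gradient f (z (Suc k)) - gradient f (z k))))"

fun coupling_sign :: "scheme \<Rightarrow> real" where
  "coupling_sign ACV_I = -1"
| "coupling_sign ACV_II = 1"
| "coupling_sign APDTR_I = -1"
| "coupling_sign APDTR_II = 1"

fun gradient_sign :: "scheme \<Rightarrow> real" where
  "gradient_sign ACV_I = -1"
| "gradient_sign ACV_II = -1"
| "gradient_sign APDTR_I = 1"
| "gradient_sign APDTR_II = 1"

text \<open>The reference triple \<open>(x\<^sup>\<star>, y\<^sup>\<star>, z\<^sup>\<star>)\<close> precedes the current point \<open>(x, y, z)\<close>.\<close>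

definition lyapunov ::
  "scheme \<Rightarrow> ('a::real_inner \<Rightarrow> real) \<Rightarrow> ('a \<Rightarrow> 'b::real_inner) \<Rightarrow> real \<Rightarrow> real \<Rightarrow> real \<Rightarrow>
   'a \<Rightarrow> 'b \<Rightarrow> 'a \<Rightarrow> 'a \<Rightarrow> 'b \<Rightarrow> 'a \<Rightarrow> real" where
  "lyapunov s f K \<eta>x \<eta>y \<eta>z xs ys zs x y z =
     1 / (2 * \<eta>x) * (norm (x - xs))\<^sup>2 + 1 / (2 * \<eta>y) * (norm (y - ys))\<^sup>2
     + 1 / \<eta>z * bregman f z zs
     + coupling_sign s * ((y - ys) \<bullet> K (x - xs))
     + gradient_sign s * ((gradient f z - gradient f zs) \<bullet> (x - xs))"

text \<open>
  The iteration bound \<open>O(\<kappa> log (1/\<epsilon>))\<close>, where \<open>\<kappa>\<close> is the condition number of the problem and \<open>O\<close>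
  hides an absolute constant, is stated as: every \<open>k \<ge> C max(1, \<kappa>) log (1/\<epsilon>)\<close> achieves accuracy \<open>\<epsilon>\<close>.
  For \<open>\<kappa> \<ge> 1\<close> this is the bound \<open>C \<kappa> log (1/\<epsilon>)\<close> itself.

  \<^item> The constant must not depend on the dimensions. These are types, over which an existentially
    quantified \<open>C\<close> could not be uniform; hence \<open>C\<close> is a numeral. The value 3 comes from the
    one-step contraction factor \<open>1/(1+\<rho>)\<close> of \<^const>\<open>lyapunov\<close> with \<open>1/\<rho> \<le> 2\<kappa>\<close>, so that
    \<open>1/ln(1+\<rho>) \<le> 1 + 1/\<rho> \<le> 3 max(1, \<kappa>)\<close>.
  \<^item> Without the lower bound 1 on the condition number no absolute constant works: nothing prevents
    \<open>\<kappa>\<close> from tending to 0, but one step reduces the Lyapunov function at best polynomially in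
    \<open>\<kappa>\<close>. For one-dimensional quadratics \<open>f = \<delta>\<^sup>2x\<^sup>2/2\<close>, \<open>g = x\<^sup>2/2\<close>, \<open>h = y\<^sup>2/2\<close>, \<open>K = \<delta>\<close>, started at
    \<open>(0, 0, 1)\<close>, ACV-I has \<open>\<kappa> = 2\<delta>\<close> and reduces it by a factor of order \<open>\<delta>\<^sup>2\<close>, not
    \<open>exp(-1/(C\<kappa>))\<close>.
\<close>

definition condition_number :: "real \<Rightarrow> real \<Rightarrow> real \<Rightarrow> real \<Rightarrow> real" where
  "condition_number L \<mu> \<nu> nK = sqrt (L / \<mu>) + sqrt (nK\<^sup>2 / (\<mu> * \<nu>))"

end

theory Submission imports Defs begin

text \<open>
  The optimality conditions of the proximal steps at an iterate and at the solution, combined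
  through strong monotonicity of the subdifferentials, and the cocoercive form of convexity of \<open>f\<close>
  at \<open>z\<^sup>k\<close>, \<open>z\<^bsup>k+1\<^esup>\<close>, \<open>z\<^sup>\<star>\<close> are summed. For each of the four schemes the extrapolation is such that
  the coupling terms of \<open>\<Psi>\<close> telescope up to the products of increments
  \<open>\<langle>y\<^bsup>k+1\<^esup> - y\<^sup>k, K(x\<^bsup>k+1\<^esup> - x\<^sup>k)\<rangle>\<close> and \<open>\<langle>\<nabla>f(z\<^bsup>k+1\<^esup>) - \<nabla>f(z\<^sup>k), x\<^bsup>k+1\<^esup> - x\<^sup>k\<rangle>\<close>, which the step sizes
  allow to be absorbed by the squared increments. What remains is
  \<open>(1 + \<rho>) \<Psi>\<^bsub>k+1\<^esub> \<le> \<Psi>\<^sub>k\<close> with \<open>\<rho> = 1/(2\<kappa>) \<le> min {\<mu> \<eta>\<^sub>x, \<nu> \<eta>\<^sub>y, \<eta>\<^sub>z}\<close>, where \<open>\<kappa>\<close> is the condition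
  number.
\<close>

section \<open>Subgradients and proximal points\<close>

lemma subdifferential_finite:
  assumes "p \<in> subdifferential \<phi> y"
  obtains b where "\<phi> y = ereal b" and "y \<in> effective_domain \<phi>"
    and "\<And>x. \<phi> x \<ge> ereal (b + p \<bullet> (x - y))"
proof -
  have fin: "\<bar>\<phi> y\<bar> \<noteq> \<infinity>" and le: "\<And>x. \<phi> x \<ge> \<phi> y + ereal (p \<bullet> (x - y))"
    using assms by (auto simp: subdifferential_def)
  from fin obtain b where b: "\<phi> y = ereal b" by (cases "\<phi> y") auto
  show thesis
    using b le by (intro that[of b]) (auto simp: effective_domain_def)
qed

text \<open>Adding the strong subgradient inequalities based at \<open>x\<close> and at
  \<open>y\<close> cancels the function values, and the two halves of \<open>\<mu>\<close> add up.
  Both values are finite because subgradients exist there, so the addition takes place in the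
  reals.\<close>

lemma strongly_convex_strongly_monotone:
  assumes sc: "strongly_convex \<mu> \<phi>"
    and p: "p \<in> subdifferential \<phi> x" and q: "q \<in> subdifferential \<phi> y"
  shows "\<mu> * (norm (x - y))\<^sup>2 \<le> (p - q) \<bullet> (x - y)"
proof -
  obtain a where a: "\<phi> x = ereal a" "x \<in> effective_domain \<phi>"
    using subdifferential_finite[OF p] by metis
  obtain b where b: "\<phi> y = ereal b" "y \<in> effective_domain \<phi>"
    using subdifferential_finite[OF q] by metis
  have sub: "\<phi> v \<ge> \<phi> u + ereal (r \<bullet> (v - u) + \<mu> / 2 * (norm (v - u))\<^sup>2)"
    if "v \<in> effective_domain \<phi>" "u \<in> effective_domain \<phi>" "r \<in> subdifferential \<phi> u" for u v r
    using sc that unfolding strongly_convex_def by blast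
  have 1: "a \<ge> b + (q \<bullet> (x - y) + \<mu> / 2 * (norm (x - y))\<^sup>2)"
    using sub[OF a(2) b(2) q] unfolding a(1) b(1) by simp
  have 2: "b \<ge> a + (p \<bullet> (y - x) + \<mu> / 2 * (norm (x - y))\<^sup>2)"
    using sub[OF b(2) a(2) p] unfolding a(1) b(1) by (simp add: norm_minus_commute)
  show ?thesis
    using 1 2 by (simp add: inner_diff_left inner_diff_right)
qed

text \<open>Weierstrass on the epigraph: over pairs \<open>(x, r)\<close> the objective becomes the
  continuous function \<open>J\<close>, and closedness of \<open>\<phi>\<close> becomes closedness
  of its domain. The subgradient \<open>p\<close> supplies both a starting point of finite value and
  the affine minorant that makes the sublevel set bounded.\<close>

lemma prox_objective_has_minimizer:
  fixes \<phi> :: "'a::euclidean_space \<Rightarrow> ereal"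
  assumes cl: "closed_fun \<phi>" and p: "p \<in> subdifferential \<phi> u" and \<eta>: "\<eta> > 0"
  obtains w b where "\<phi> w = ereal b"
    and "\<And>x r. \<phi> x \<le> ereal r \<Longrightarrow>
      \<eta> * b + 1 / 2 * (norm (w - v))\<^sup>2 \<le> \<eta> * r + 1 / 2 * (norm (x - v))\<^sup>2"
proof -
  obtain b0 where b0: "\<phi> u = ereal b0" "\<And>x. \<phi> x \<ge> ereal (b0 + p \<bullet> (x - u))"
    using subdifferential_finite[OF p] by metis
  define J :: "'a \<times> real \<Rightarrow> real"
    where "J = (\<lambda>z. \<eta> * snd z + 1 / 2 * (norm (fst z - v))\<^sup>2)"
  define c where "c = J (u, b0)"
  define S where "S = extended_epigraph \<phi> \<inter> {z. J z \<le> c}"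
  have contJ: "continuous_on A J" for A
    unfolding J_def by (intro continuous_intros)
  have "closed {z. J z \<le> c}"
    by (intro closed_Collect_le contJ continuous_intros)
  then have "closed S"
    using cl by (auto simp: S_def closed_fun_def)
  moreover have "bounded S"
  proof -
    \<comment> \<open>On \<open>S\<close> the affine minorant of \<open>\<phi>\<close> bounds \<open>|x - v|\<^sup>2/2\<close> by an affine function of \<open>|x - v|\<close>.\<close>
    define e where "e = c - \<eta> * (b0 + p \<bullet> (v - u))"
    \<comment> \<open>For \<open>t \<ge> 1\<close> the bound
      \<open>t\<^sup>2 / 2 \<le> e + \<eta> * norm p * t\<close> can be divided by \<open>t\<close>,
      which yields the first two summands. The summand 1 ensures that \<open>t > R\<close> implies
      \<open>t \<ge> 1\<close>. In \<open>T\<close>, the lower bound for \<open>r\<close> comes from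
      the affine minorant, the upper one from \<open>J \<le> c\<close>.\<close>
    define R where "R = 2 * \<eta> * norm p + 2 * \<bar>e\<bar> + 1"
    define T where "T = max \<bar>b0 + p \<bullet> (v - u) - norm p * R\<bar> \<bar>c / \<eta>\<bar>"
    have "norm (fst z - v) \<le> R \<and> \<bar>snd z\<bar> \<le> T" if z: "z \<in> S" for z
    proof -
      obtain x r where zz: "z = (x, r)" by force
      have "\<phi> x \<le> ereal r" and J: "J (x, r) \<le> c"
        using z by (auto simp: S_def zz extended_epigraph_def)
      then have "ereal (b0 + p \<bullet> (x - u)) \<le> ereal r"
        using b0(2) order_trans by blast
      then have r: "b0 + p \<bullet> (v - u) + p \<bullet> (x - v) \<le> r"
        by (simp add: inner_diff_right)
      define t where "t = norm (x - v)"
      have t0: "t \<ge> 0" by (simp add: t_def)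
      have pt: "\<bar>p \<bullet> (x - v)\<bar> \<le> norm p * t"
        unfolding t_def by (rule Cauchy_Schwarz_ineq2)
      have J': "\<eta> * r + 1 / 2 * t\<^sup>2 \<le> c"
        using J by (simp add: J_def t_def)
      have "\<eta> * (b0 + p \<bullet> (v - u) - norm p * t) \<le> \<eta> * r"
        using r pt \<eta> by (intro mult_left_mono) auto
      then have q: "1 / 2 * t\<^sup>2 \<le> e + \<eta> * norm p * t"
        using J' by (simp add: e_def algebra_simps)
      have tR: "t \<le> R"
      proof (rule ccontr)
        assume "\<not> t \<le> R"
        then have gt: "t > R" by simp
        have R1: "R \<ge> 1" using \<eta> by (simp add: R_def)
        then have "t \<ge> 1" using gt by simp
        then have "\<bar>e\<bar> * 1 \<le> \<bar>e\<bar> * t" by (intro mult_left_mono) auto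
        then have "t * t \<le> (2 * \<bar>e\<bar> + 2 * \<eta> * norm p) * t"
          using q by (simp add: power2_eq_square algebra_simps)
        then have "t \<le> 2 * \<bar>e\<bar> + 2 * \<eta> * norm p"
          using \<open>t \<ge> 1\<close> by simp
        then show False using gt by (simp add: R_def)
      qed
      have "norm p * t \<le> norm p * R" using tR by (intro mult_left_mono) auto
      then have lo: "b0 + p \<bullet> (v - u) - norm p * R \<le> r" using r pt by linarith
      have "\<eta> * r \<le> c" using J' zero_le_power2[of t] by linarith
      then have "r \<le> c / \<eta>" using \<eta> by (simp add: pos_le_divide_eq mult.commute)
      then have "\<bar>r\<bar> \<le> T" using lo unfolding T_def by linarith
      then show ?thesis using tR by (simp add: zz t_def)
    qed
    then have "S \<subseteq> cball v R \<times> cball 0 T"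
      by (auto simp: dist_norm norm_minus_commute mem_Times_iff)
    then show ?thesis
      using bounded_subset bounded_Times bounded_cball by metis
  qed
  ultimately have "compact S" by (simp add: compact_eq_bounded_closed)
  moreover have start: "(u, b0) \<in> S"
    using b0 by (auto simp: S_def c_def extended_epigraph_def)
  ultimately obtain z where z: "z \<in> S" "\<forall>y\<in>S. J z \<le> J y"
    using continuous_attains_inf[OF _ _ contJ] by blast
  obtain w r where zz: "z = (w, r)" by force
  \<comment> \<open>Outside \<open>S\<close> the objective exceeds \<open>c\<close>, its value at
    the point \<open>(u, b0)\<close> of \<open>S\<close>, so the minimum over \<open>S\<close> is
    the minimum over the whole epigraph.\<close>
  have min: "J z \<le> J (x, s)" if "\<phi> x \<le> ereal s" for x s
  proof (cases "J (x, s) \<le> c")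
    case True
    then have "(x, s) \<in> S" using that by (auto simp: S_def extended_epigraph_def)
    then show ?thesis using z by blast
  next
    case False
    then show ?thesis using z start by (auto simp: c_def)
  qed
  have wr: "\<phi> w \<le> ereal r" using z by (auto simp: S_def zz extended_epigraph_def)
  moreover have "\<phi> w \<noteq> -\<infinity>" using b0(2)[of w] by auto
  ultimately obtain b where b: "\<phi> w = ereal b" by (cases "\<phi> w") auto
  \<comment> \<open>The minimizing pair might lie above the graph; lowering its second component to
    \<open>b\<close> does not increase the objective.\<close>
  have "b \<le> r" using wr b by simp
  then have "\<eta> * b \<le> \<eta> * r" using \<eta> by simp
  then show thesis
    using that[OF b] min by (force simp: zz J_def)
qed

text \<open>\<open>prox\<close> is a choice made by \<open>arg_min\<close>, so it is a minimizer
  only because some minimizer exists. Comparing with that one shows that the chosen point has a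
  finite value and the same minimality over the epigraph.\<close>

lemma prox_is_minimizer:
  fixes \<phi> :: "'a::euclidean_space \<Rightarrow> ereal"
  assumes cl: "closed_fun \<phi>" and p: "p \<in> subdifferential \<phi> u" and \<eta>: "\<eta> > 0"
  obtains b where "\<phi> (prox (\<lambda>w. ereal \<eta> * \<phi> w) v) = ereal b"
    and "\<And>x r. \<phi> x \<le> ereal r \<Longrightarrow>
      \<eta> * b + 1 / 2 * (norm (prox (\<lambda>w. ereal \<eta> * \<phi> w) v - v))\<^sup>2
        \<le> \<eta> * r + 1 / 2 * (norm (x - v))\<^sup>2"
proof -
  obtain w b where w: "\<phi> w = ereal b"
    and min: "\<And>x r. \<phi> x \<le> ereal r \<Longrightarrow>
      \<eta> * b + 1 / 2 * (norm (w - v))\<^sup>2 \<le> \<eta> * r + 1 / 2 * (norm (x - v))\<^sup>2"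
    using prox_objective_has_minimizer[OF cl p \<eta>] by metis
  define F where "F = (\<lambda>w. ereal \<eta> * \<phi> w + ereal (1 / 2 * (norm (w - v))\<^sup>2))"
  have F: "F x = ereal (\<eta> * r + 1 / 2 * (norm (x - v))\<^sup>2)" if "\<phi> x = ereal r" for x r
    using that by (simp add: F_def)
  obtain b0 where b0: "\<And>x. \<phi> x \<ge> ereal (b0 + p \<bullet> (x - u))"
    using subdifferential_finite[OF p] by metis
  have Fle: "F w \<le> F x" for x
  proof (cases "\<phi> x")
    case (real r)
    then show ?thesis using min[of x r] by (simp add: F[OF w] F[OF real])
  next
    case PInf
    then show ?thesis using \<eta> by (simp add: F_def)
  next
    case MInf
    then show ?thesis using b0[of x] by simp
  qed
  define y where "y = prox (\<lambda>w. ereal \<eta> * \<phi> w) v"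
  have "is_arg_min F (\<lambda>_. True) w"
    using Fle by (auto simp: is_arg_min_def not_less)
  then have "is_arg_min F (\<lambda>_. True) y"
    unfolding y_def prox_def F_def[symmetric] arg_min_def by (rule someI)
  then have "F y \<le> F w" by (auto simp: is_arg_min_def not_less)
  then have le: "ereal \<eta> * \<phi> y + ereal (1 / 2 * (norm (y - v))\<^sup>2)
      \<le> ereal (\<eta> * b + 1 / 2 * (norm (w - v))\<^sup>2)"
    by (simp add: F[OF w]) (simp add: F_def)
  have "\<phi> y \<noteq> \<infinity>" using le \<eta> by auto
  moreover have "\<phi> y \<noteq> -\<infinity>" using b0[of y] by auto
  ultimately obtain a where a: "\<phi> y = ereal a" by (cases "\<phi> y") auto
  have "\<eta> * a + 1 / 2 * (norm (y - v))\<^sup>2 \<le> \<eta> * b + 1 / 2 * (norm (w - v))\<^sup>2"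
    using le by (simp add: a)
  then show thesis
    using that[of a] a min order_trans unfolding y_def by blast
qed

text \<open>Fermat's rule, proved directly: the objective at \<open>w\<close> is compared with that
  at \<open>w + t (x - w)\<close>. Convexity bounds \<open>\<phi>\<close> there by the chord, and
  division by \<open>t\<close> leaves a remainder of order \<open>t\<close>, which vanishes as
  \<open>t\<close> tends to 0.\<close>

lemma prox_subgradient:
  fixes \<phi> :: "'a::euclidean_space \<Rightarrow> ereal"
  assumes cl: "closed_fun \<phi>" and cv: "convex_fun \<phi>"
    and p: "p \<in> subdifferential \<phi> u" and \<eta>: "\<eta> > 0"
    and w: "w = prox (\<lambda>w. ereal \<eta> * \<phi> w) v"
  shows "(1 / \<eta>) *\<^sub>R (v - w) \<in> subdifferential \<phi> w"
proof -
  obtain b where b: "\<phi> w = ereal b"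
    and min: "\<And>x r. \<phi> x \<le> ereal r \<Longrightarrow>
      \<eta> * b + 1 / 2 * (norm (w - v))\<^sup>2 \<le> \<eta> * r + 1 / 2 * (norm (x - v))\<^sup>2"
    using prox_is_minimizer[OF cl p \<eta>] unfolding w by metis
  obtain b0 where b0: "\<And>x. \<phi> x \<ge> ereal (b0 + p \<bullet> (x - u))"
    using subdifferential_finite[OF p] by metis
  have "b + (1 / \<eta>) * ((v - w) \<bullet> (x - w)) \<le> r" if x: "\<phi> x = ereal r" for x r
  proof -
    have step: "\<eta> * b - \<eta> * r + (v - w) \<bullet> (x - w) \<le> t * ((norm (x - w))\<^sup>2 / 2)"
      if t: "0 < t" "t < 1" for t
    proof -
      have "(w, b) \<in> extended_epigraph \<phi>" "(x, r) \<in> extended_epigraph \<phi>"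
        using b x by (auto simp: extended_epigraph_def)
      then have "(1 - t) *\<^sub>R (w, b) + t *\<^sub>R (x, r) \<in> extended_epigraph \<phi>"
        using cv t unfolding convex_fun_def by (intro convexD) auto
      then have "\<phi> ((1 - t) *\<^sub>R w + t *\<^sub>R x) \<le> ereal ((1 - t) * b + t * r)"
        by (simp add: extended_epigraph_def)
      from min[OF this]
      have "\<eta> * b + 1 / 2 * (norm (w - v))\<^sup>2
          \<le> \<eta> * ((1 - t) * b + t * r) + 1 / 2 * (norm ((w - v) + t *\<^sub>R (x - w)))\<^sup>2"
        by (simp add: algebra_simps)
      also have "(norm ((w - v) + t *\<^sub>R (x - w)))\<^sup>2
          = (norm (w - v))\<^sup>2 + 2 * t * ((w - v) \<bullet> (x - w)) + t\<^sup>2 * (norm (x - w))\<^sup>2"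
        unfolding power2_norm_eq_inner
        by (simp add: inner_add_left inner_add_right inner_commute power2_eq_square)
      finally have "t * (\<eta> * b - \<eta> * r + (v - w) \<bullet> (x - w)) \<le> t * (t * ((norm (x - w))\<^sup>2 / 2))"
        by (simp add: inner_diff_left algebra_simps power2_eq_square)
      then show ?thesis using t by simp
    qed
    have "\<eta> * b - \<eta> * r + (v - w) \<bullet> (x - w) \<le> 0"
    proof (rule tendsto_lowerbound)
      show "((\<lambda>t. t * ((norm (x - w))\<^sup>2 / 2)) \<longlongrightarrow> 0) (at_right 0)"
        by (auto intro!: tendsto_eq_intros)
      show "\<forall>\<^sub>F t in at_right 0.
          \<eta> * b - \<eta> * r + (v - w) \<bullet> (x - w) \<le> t * ((norm (x - w))\<^sup>2 / 2)"
        using eventually_at_right_real[of 0 "1::real"]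
        by (rule eventually_mono) (use step in auto)
    qed simp
    then have "\<eta> * (b + (1 / \<eta>) * ((v - w) \<bullet> (x - w))) \<le> \<eta> * r"
      using \<eta> by (simp add: algebra_simps)
    then show ?thesis using \<eta> by simp
  qed
  then have "\<phi> x \<ge> \<phi> w + ereal ((1 / \<eta>) *\<^sub>R (v - w) \<bullet> (x - w))" for x
    using b b0[of x] by (cases "\<phi> x") auto
  then show ?thesis using b by (auto simp: subdifferential_def)
qed

section \<open>Convex functions with Lipschitz gradient\<close>

text \<open>Since \<open>gradient\<close> is a definite description, existence and uniqueness are
  both due. The representing vector is the adjoint of the derivative applied to 1; two candidates
  agree by testing on their difference.\<close>

lemma has_derivative_gradient:
  fixes f :: "'a::euclidean_space \<Rightarrow> real"
  assumes "f differentiable (at x)"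
  shows "(f has_derivative (\<lambda>h. h \<bullet> gradient f x)) (at x)"
proof -
  obtain F where F: "(f has_derivative F) (at x)"
    using assms by (auto simp: differentiable_def)
  interpret F: bounded_linear F using F by (rule has_derivative_bounded_linear)
  define D where "D = adjoint F 1"
  have "F h = h \<bullet> D" for h
    using adjoint_works[OF F.linear_axioms, of h 1] by (simp add: D_def)
  then have D: "GDERIV f x :> D"
    using F by (simp add: gderiv_def ext[of F "\<lambda>h. h \<bullet> D"])
  moreover have "D' = D" if "GDERIV f x :> D'" for D'
  proof -
    have "(\<lambda>h. h \<bullet> D') = (\<lambda>h. h \<bullet> D)"
      using that D unfolding gderiv_def by (rule has_derivative_unique)
    then have "(D' - D) \<bullet> D' = (D' - D) \<bullet> D" by meson
    then show ?thesis by (metis eq_iff_diff_eq_0 inner_diff_right inner_eq_zero_iff)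
  qed
  ultimately have "GDERIV f x :> gradient f x"
    unfolding gradient_def by (metis theI)
  then show ?thesis by (simp add: gderiv_def)
qed

lemma DERIV_along_line:
  fixes f :: "'a::euclidean_space \<Rightarrow> real"
  assumes "smooth_fun L f"
  shows "((\<lambda>t. f (x + t *\<^sub>R d)) has_real_derivative d \<bullet> gradient f (x + t *\<^sub>R d)) (at t)"
proof -
  have "(f has_derivative (\<lambda>h. h \<bullet> gradient f (x + t *\<^sub>R d))) (at (x + t *\<^sub>R d))"
    using assms by (intro has_derivative_gradient) (auto simp: smooth_fun_def)
  moreover have "((\<lambda>t. x + t *\<^sub>R d) has_derivative (\<lambda>s. s *\<^sub>R d)) (at t)"
    by (auto intro!: derivative_eq_intros)
  ultimately have "((\<lambda>t. f (x + t *\<^sub>R d)) has_derivative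
      (\<lambda>s. (s *\<^sub>R d) \<bullet> gradient f (x + t *\<^sub>R d))) (at t)"
    using has_derivative_compose by blast
  then show ?thesis
    by (simp add: has_field_derivative_def mult_commute_abs)
qed

text \<open>Restricted to the line through \<open>x\<close> and \<open>y\<close>, this is the
  tangent inequality for convex functions of one real variable.\<close>

lemma convex_gradient_inequality:
  fixes f :: "'a::euclidean_space \<Rightarrow> real"
  assumes "convex_on UNIV f" and "smooth_fun L f"
  shows "f x + gradient f x \<bullet> (y - x) \<le> f y"
proof -
  define \<phi> where "\<phi> = (\<lambda>t. f (x + t *\<^sub>R (y - x)))"
  have "convex_on UNIV \<phi>"
  proof (rule convex_onI)
    fix t a b :: real assume t: "0 < t" "t < 1"
    have "x + ((1 - t) *\<^sub>R a + t *\<^sub>R b) *\<^sub>R (y - x)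
        = (1 - t) *\<^sub>R (x + a *\<^sub>R (y - x)) + t *\<^sub>R (x + b *\<^sub>R (y - x))"
      by (simp add: algebra_simps)
    then show "\<phi> ((1 - t) *\<^sub>R a + t *\<^sub>R b) \<le> (1 - t) * \<phi> a + t * \<phi> b"
      unfolding \<phi>_def using convex_onD[OF assms(1), of t] t by simp
  qed simp
  moreover have "(\<phi> has_real_derivative (y - x) \<bullet> gradient f x) (at 0)"
    using DERIV_along_line[OF assms(2), of x "y - x" 0] by (simp add: \<phi>_def)
  ultimately have "\<phi> 1 - \<phi> 0 \<ge> ((y - x) \<bullet> gradient f x) * (1 - 0)"
    by (intro convex_on_imp_above_tangent[where A = UNIV]) auto
  then show ?thesis by (simp add: \<phi>_def inner_commute)
qed

lemma smooth_descent:
  fixes f :: "'a::euclidean_space \<Rightarrow> real"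
  assumes "smooth_fun L f"
  shows "f y \<le> f x + gradient f x \<bullet> (y - x) + L / 2 * (norm (y - x))\<^sup>2"
proof -
  define d where "d = y - x"
  \<comment> \<open>The difference between \<open>f\<close> on the segment and its quadratic upper
    model, up to the constant \<open>f x\<close>. The Lipschitz bound on the gradient makes its
    derivative nonpositive.\<close>
  define \<phi> where
    "\<phi> = (\<lambda>t. f (x + t *\<^sub>R d) - t * (gradient f x \<bullet> d) - L / 2 * t\<^sup>2 * (norm d)\<^sup>2)"
  have "\<phi> 1 \<le> \<phi> 0"
  proof (rule DERIV_nonpos_imp_nonincreasing[where f = \<phi> and a = 0 and b = 1])
    fix t :: real assume t: "0 \<le> t" "t \<le> 1"
    define D where
      "D = d \<bullet> gradient f (x + t *\<^sub>R d) - gradient f x \<bullet> d - L * t * (norm d)\<^sup>2"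
    have "(\<phi> has_real_derivative D) (at t)"
      unfolding \<phi>_def D_def
      by (auto intro!: derivative_eq_intros DERIV_along_line[OF assms])
    moreover have "D \<le> 0"
    proof -
      have "dist (gradient f (x + t *\<^sub>R d)) (gradient f x) \<le> L * dist (x + t *\<^sub>R d) x"
        using assms by (auto simp: smooth_fun_def intro: lipschitz_onD)
      then have "norm (gradient f (x + t *\<^sub>R d) - gradient f x) \<le> L * t * norm d"
        using t by (simp add: dist_norm)
      then have "norm d * norm (gradient f (x + t *\<^sub>R d) - gradient f x) \<le> norm d * (L * t * norm d)"
        by (intro mult_left_mono) auto
      moreover have "d \<bullet> (gradient f (x + t *\<^sub>R d) - gradient f x)
          \<le> norm d * norm (gradient f (x + t *\<^sub>R d) - gradient f x)"
        by (rule norm_cauchy_schwarz)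
      ultimately show ?thesis
        by (simp add: D_def inner_diff_right inner_commute power2_eq_square algebra_simps)
    qed
    ultimately show "\<exists>D. (\<phi> has_real_derivative D) (at t) \<and> D \<le> 0" by blast
  qed simp
  then show ?thesis by (simp add: \<phi>_def d_def)
qed

text \<open>
  The step \<open>y - (\<nabla>f(y) - \<nabla>f(x))/L\<close> minimizes the upper bound of the descent inequality for the
  convex function \<open>f - \<langle>\<nabla>f(x), \<cdot>\<rangle>\<close>, whose minimum is attained at \<open>x\<close>.
\<close>

lemma convex_smooth_cocoercive:
  fixes f :: "'a::euclidean_space \<Rightarrow> real"
  assumes "convex_on UNIV f" and "smooth_fun L f" and L: "L > 0"
  shows "f x + gradient f x \<bullet> (y - x) + 1 / (2 * L) * (norm (gradient f y - gradient f x))\<^sup>2 \<le> f y"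
proof -
  define u where "u = gradient f y - gradient f x"
  define w where "w = y - (1 / L) *\<^sub>R u"
  have 1: "f x + gradient f x \<bullet> (w - x) \<le> f w"
    using assms by (intro convex_gradient_inequality)
  have "f w \<le> f y + gradient f y \<bullet> (w - y) + L / 2 * (norm (w - y))\<^sup>2"
    using assms by (intro smooth_descent)
  also have "L / 2 * (norm (w - y))\<^sup>2 = 1 / (2 * L) * (norm u)\<^sup>2"
    using L by (simp add: w_def power2_eq_square field_simps)
  finally have 2: "f w \<le> f y + gradient f y \<bullet> (w - y) + 1 / (2 * L) * (norm u)\<^sup>2" .
  \<comment> \<open>The gradient terms contribute \<open>- (norm u)\<^sup>2 / L\<close>, of which
    the descent inequality gives back only half.\<close>
  have 3: "gradient f y \<bullet> (w - y) - gradient f x \<bullet> (w - x)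
      = - gradient f x \<bullet> (y - x) - 2 * (1 / (2 * L) * (norm u)\<^sup>2)"
  proof -
    have "(1 / L) * (u \<bullet> u) = 2 * (1 / (2 * L) * (norm u)\<^sup>2)"
      by (simp add: power2_norm_eq_inner)
    moreover have "gradient f y \<bullet> (w - y) - gradient f x \<bullet> (w - x)
        = - gradient f x \<bullet> (y - x) - (1 / L) * (u \<bullet> u)"
      by (simp add: w_def u_def inner_diff_left inner_diff_right algebra_simps inner_commute)
    ultimately show ?thesis by simp
  qed
  show ?thesis
    using 1 2 3 unfolding u_def[symmetric] by simp
qed

section \<open>One step of the primal-dual schemes\<close>

text \<open>The dual function \<open>hc\<close> is kept abstract and becomes
  \<open>convex_conjugate h\<close> only in the theorem; only its strong convexity matters, not
  conjugacy. The third component of the solution is identified with \<open>xs\<close>.\<close>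

locale saddle_point =
  fixes f :: "'a::euclidean_space \<Rightarrow> real"
    and g :: "'a \<Rightarrow> ereal"
    and hc :: "'b::euclidean_space \<Rightarrow> ereal"
    and K :: "'a \<Rightarrow> 'b"
    and L \<mu> \<nu> :: real
    and xs :: 'a and ys :: 'b
  assumes convex_f: "convex_on UNIV f" and smooth_f: "smooth_fun L f" and L_pos: "L > 0"
    and convex_g: "strongly_convex \<mu> g" and \<mu>_pos: "\<mu> > 0"
    and convex_hc: "strongly_convex \<nu> hc" and \<nu>_pos: "\<nu> > 0"
    and linear_K: "linear K"
    and primal_optimal: "- adjoint K ys - gradient f xs \<in> subdifferential g xs"
    and dual_optimal: "K xs \<in> subdifferential hc ys"
begin

lemma adjoint_K: "adjoint K y \<bullet> x = y \<bullet> K x"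
  using adjoint_works[OF linear_K, of x y] by (simp add: inner_commute)

lemmas K_simps = linear_add[OF linear_K] linear_diff[OF linear_K] linear_cmul[OF linear_K]

lemma cocoercive:
  "f x + gradient f x \<bullet> (y - x) + 1 / (2 * L) * (norm (gradient f y - gradient f x))\<^sup>2 \<le> f y"
  using convex_f smooth_f L_pos by (rule convex_smooth_cocoercive)

lemma gradient_monotone: "0 \<le> (gradient f x - gradient f y) \<bullet> (x - y)"
  using convex_gradient_inequality[OF convex_f smooth_f, of x y]
    convex_gradient_inequality[OF convex_f smooth_f, of y x]
  by (simp add: inner_diff_left inner_diff_right)

text \<open>The coupling enters the primal and dual monotonicity inequalities with opposite signs.
  In their sum only the strong convexity terms and the monotone gradient term survive.\<close>

lemma unique:
  assumes p: "- adjoint K y - gradient f x \<in> subdifferential g x"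
    and q: "K x \<in> subdifferential hc y"
  shows "x = xs \<and> y = ys"
proof -
  have "\<mu> * (norm (x - xs))\<^sup>2
      \<le> ((- adjoint K y - gradient f x) - (- adjoint K ys - gradient f xs)) \<bullet> (x - xs)"
    by (rule strongly_convex_strongly_monotone[OF convex_g p primal_optimal])
  also have "\<dots> = - ((y - ys) \<bullet> K (x - xs)) - (gradient f x - gradient f xs) \<bullet> (x - xs)"
    by (simp add: inner_diff_left adjoint_K)
  finally have 1: "\<mu> * (norm (x - xs))\<^sup>2 \<le> - ((y - ys) \<bullet> K (x - xs))"
    using gradient_monotone[of x xs] by linarith
  have "\<nu> * (norm (y - ys))\<^sup>2 \<le> (K x - K xs) \<bullet> (y - ys)"
    by (rule strongly_convex_strongly_monotone[OF convex_hc q dual_optimal])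
  then have "\<nu> * (norm (y - ys))\<^sup>2 \<le> (y - ys) \<bullet> K (x - xs)"
    by (simp add: K_simps inner_commute)
  then have le: "\<mu> * (norm (x - xs))\<^sup>2 + \<nu> * (norm (y - ys))\<^sup>2 \<le> 0"
    using 1 by linarith
  have "0 \<le> \<mu> * (norm (x - xs))\<^sup>2" "0 \<le> \<nu> * (norm (y - ys))\<^sup>2"
    using \<mu>_pos \<nu>_pos by simp_all
  then have "\<mu> * (norm (x - xs))\<^sup>2 = 0" "\<nu> * (norm (y - ys))\<^sup>2 = 0"
    using le by linarith+
  then show ?thesis using \<mu>_pos \<nu>_pos by simp
qed

end

text \<open>Young's inequality by completing the square \<open>(s - c * b * t)\<^sup>2\<close>. The
  weights are uneven on purpose: \<open>t\<close> will be a primal quantity, which has to pay for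
  two products out of \<open>t\<^sup>2 / (2 * a)\<close>.\<close>

lemma product_le_weighted_squares:
  fixes a b c s t :: real
  assumes a: "a > 0" and b: "b > 0" and "c\<^sup>2 * a * b \<le> 1 / 2"
  shows "c * s * t \<le> s\<^sup>2 / (2 * b) + t\<^sup>2 / (4 * a)"
proof -
  have "c\<^sup>2 * b / 2 \<le> 1 / (4 * a)"
    using assms by (simp add: field_simps)
  then have "c\<^sup>2 * b / 2 * t\<^sup>2 \<le> 1 / (4 * a) * t\<^sup>2"
    by (rule mult_right_mono) simp
  moreover have "0 \<le> (s - c * b * t)\<^sup>2 / (2 * b)"
    using b by simp
  moreover have "(s - c * b * t)\<^sup>2 / (2 * b) = s\<^sup>2 / (2 * b) - c * s * t + c\<^sup>2 * b / 2 * t\<^sup>2"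
    using b by (simp add: power2_eq_square field_simps)
  ultimately show ?thesis by simp
qed

text \<open>Besides positivity, these two bounds are all that the one-step decrease needs from the
  step sizes; each is the hypothesis of \<open>product_le_weighted_squares\<close> for one
  coupling.\<close>

locale saddle_point_steps = saddle_point +
  fixes \<eta>x \<eta>y \<eta>z :: real
  assumes steps_pos: "\<eta>x > 0" "\<eta>y > 0" "\<eta>z > 0"
    and coupling_step: "(onorm K)\<^sup>2 * \<eta>x * \<eta>y \<le> 1 / 2"
    and gradient_step: "L * \<eta>x * \<eta>z \<le> 1 / 2"
begin

lemma coupling_le: "\<bar>v \<bullet> K u\<bar> \<le> (norm v)\<^sup>2 / (2 * \<eta>y) + (norm u)\<^sup>2 / (4 * \<eta>x)"
proof -
  have "norm (K u) \<le> onorm K * norm u"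
    using linear_K by (simp add: linear_conv_bounded_linear onorm)
  then have "norm v * norm (K u) \<le> norm v * (onorm K * norm u)"
    by (intro mult_left_mono) auto
  then have "\<bar>v \<bullet> K u\<bar> \<le> onorm K * norm v * norm u"
    using Cauchy_Schwarz_ineq2[of v "K u"] by (simp add: mult_ac)
  also have "\<dots> \<le> (norm v)\<^sup>2 / (2 * \<eta>y) + (norm u)\<^sup>2 / (4 * \<eta>x)"
    by (intro product_le_weighted_squares steps_pos coupling_step)
  finally show ?thesis .
qed

text \<open>The gradient acts like a second dual variable, with step \<open>L * \<eta>z\<close> and
  the identity as coupling operator.\<close>

lemma gradient_coupling_le: "\<bar>w \<bullet> u\<bar> \<le> (norm w)\<^sup>2 / (2 * (L * \<eta>z)) + (norm u)\<^sup>2 / (4 * \<eta>x)"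
proof -
  have "1 * norm w * norm u \<le> (norm w)\<^sup>2 / (2 * (L * \<eta>z)) + (norm u)\<^sup>2 / (4 * \<eta>x)"
    using gradient_step
    by (intro product_le_weighted_squares steps_pos mult_pos_pos L_pos) (simp add: mult_ac)
  then show ?thesis using Cauchy_Schwarz_ineq2[of w u] by simp
qed

section \<open>Two-sided bounds on the Lyapunov function\<close>

abbreviation \<Psi> :: "scheme \<Rightarrow> 'a \<Rightarrow> 'b \<Rightarrow> 'a \<Rightarrow> real" where
  "\<Psi> s x y z \<equiv> lyapunov s f K \<eta>x \<eta>y \<eta>z xs ys xs x y z"

lemma coupling_signs: "\<bar>coupling_sign s * r\<bar> = \<bar>r\<bar>" "\<bar>gradient_sign s * r\<bar> = \<bar>r\<bar>"
  by (cases s; simp)+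

lemma bregman_ge: "1 / (2 * L) * (norm (gradient f z - gradient f xs))\<^sup>2 \<le> bregman f z xs"
  using cocoercive[of xs z] by (simp add: bregman_def)

text \<open>The couplings add two quarters to the primal weight and double the dual one. The
  resulting four terms are, up to step sizes and moduli, those gained in
  \<open>lyapunov_decrease\<close>.\<close>

lemma lyapunov_le:
  "\<Psi> s x y z \<le> (norm (x - xs))\<^sup>2 / \<eta>x + (norm (y - ys))\<^sup>2 / \<eta>y + bregman f z xs / \<eta>z
    + (norm (gradient f z - gradient f xs))\<^sup>2 / (2 * (L * \<eta>z))"
  using coupling_le[of "y - ys" "x - xs"]
    gradient_coupling_le[of "gradient f z - gradient f xs" "x - xs"]
    abs_le_D1[OF eq_refl[OF coupling_signs(1)], of s "(y - ys) \<bullet> K (x - xs)"]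
    abs_le_D1[OF eq_refl[OF coupling_signs(2)], of s "(gradient f z - gradient f xs) \<bullet> (x - xs)"]
  unfolding lyapunov_def by simp

text \<open>The couplings can consume exactly the primal and dual squares, and the remaining
  gradient square is covered by the Bregman term through cocoercivity.\<close>

lemma lyapunov_nonneg: "0 \<le> \<Psi> s x y z"
proof -
  have "1 / (2 * L) * (norm (gradient f z - gradient f xs))\<^sup>2 / \<eta>z \<le> bregman f z xs / \<eta>z"
    using bregman_ge steps_pos(3) by (intro divide_right_mono) auto
  then have "(norm (gradient f z - gradient f xs))\<^sup>2 / (2 * (L * \<eta>z)) \<le> bregman f z xs / \<eta>z"
    by (simp add: mult_ac)
  then show ?thesis
    using coupling_le[of "y - ys" "x - xs"]
      gradient_coupling_le[of "gradient f z - gradient f xs" "x - xs"]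
      abs_le_D2[OF eq_refl[OF coupling_signs(1)], of s "(y - ys) \<bullet> K (x - xs)"]
      abs_le_D2[OF eq_refl[OF coupling_signs(2)], of s "(gradient f z - gradient f xs) \<bullet> (x - xs)"]
    unfolding lyapunov_def by simp
qed

text \<open>The averaging step is implicit: \<open>z' - z = \<eta>z *\<^sub>R (zb - z')\<close>.
  Cocoercivity between \<open>z'\<close> and \<open>z\<close>, divided by \<open>\<eta>z\<close>,
  gives the decrease with the squared gradient increment; cocoercivity between \<open>z'\<close> and
  \<open>xs\<close> gives the two extra terms that later produce the rate.\<close>

lemma bregman_step:
  assumes z': "z' = (1 / (1 + \<eta>z)) *\<^sub>R z + (\<eta>z / (1 + \<eta>z)) *\<^sub>R zb"
  shows "bregman f z' xs / \<eta>z + bregman f z' xs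
      + (norm (gradient f z' - gradient f xs))\<^sup>2 / (2 * L)
      + (norm (gradient f z' - gradient f z))\<^sup>2 / (2 * (L * \<eta>z))
    \<le> bregman f z xs / \<eta>z + (gradient f z' - gradient f xs) \<bullet> (zb - xs)"
proof -
  define G where "G = gradient f z' - gradient f xs"
  have "(1 + \<eta>z) *\<^sub>R z' = z + \<eta>z *\<^sub>R zb"
    using steps_pos(3) by (simp add: z' scaleR_add_right)
  then have zz: "z' - z = \<eta>z *\<^sub>R (zb - z')"
    by (simp add: algebra_simps)
  have "bregman f z' xs + 1 / (2 * L) * (norm (gradient f z' - gradient f z))\<^sup>2
      \<le> bregman f z xs + G \<bullet> (z' - z)"
    using cocoercive[of z' z]
    by (simp add: bregman_def G_def inner_diff_left inner_diff_right norm_minus_commute)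
  then have "(bregman f z' xs + 1 / (2 * L) * (norm (gradient f z' - gradient f z))\<^sup>2) / \<eta>z
      \<le> (bregman f z xs + \<eta>z * (G \<bullet> (zb - z'))) / \<eta>z"
    unfolding zz using steps_pos(3) by (intro divide_right_mono) auto
  then have 1: "bregman f z' xs / \<eta>z + (norm (gradient f z' - gradient f z))\<^sup>2 / (2 * (L * \<eta>z))
      \<le> bregman f z xs / \<eta>z + G \<bullet> (zb - z')"
    using steps_pos(3) by (simp add: add_divide_distrib mult_ac)
  have 2: "bregman f z' xs + (norm G)\<^sup>2 / (2 * L) \<le> G \<bullet> (z' - xs)"
    using cocoercive[of z' xs]
    by (simp add: bregman_def G_def inner_diff_left inner_diff_right norm_minus_commute)
  have "G \<bullet> (zb - z') + G \<bullet> (z' - xs) = G \<bullet> (zb - xs)"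
    by (simp add: inner_diff_right)
  then show ?thesis using 1 2 unfolding G_def[symmetric] by linarith
qed

section \<open>The four schemes in one form and their one-step decrease\<close>

lemma inner_decrement: "(a - b) \<bullet> b = ((norm a)\<^sup>2 - (norm b)\<^sup>2 - (norm (b - a))\<^sup>2) / 2"
  for a b :: "'c::real_inner"
  by (simp add: power2_norm_eq_inner inner_diff_left inner_diff_right inner_commute)

text \<open>
  The points \<open>xb\<close>, \<open>yb\<close>, \<open>wb\<close>, \<open>zb\<close> are the arguments, extrapolated or not, at which a scheme
  evaluates the coupling in the dual and primal steps, the gradient, and the averaging step.
\<close>

definition extrapolates :: "scheme \<Rightarrow> 'a \<Rightarrow> 'b \<Rightarrow> 'a \<Rightarrow> 'a \<Rightarrow> 'b \<Rightarrow> 'a \<Rightarrow> 'a \<Rightarrow> 'b \<Rightarrow> 'a \<Rightarrow> 'a \<Rightarrow> bool"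
  where "extrapolates s x y z x' y' z' xb yb wb zb \<longleftrightarrow>
    (coupling_sign s = -1 \<and> xb = 2 *\<^sub>R x' - x \<and> yb = y \<or>
     coupling_sign s = 1 \<and> xb = x \<and> yb = 2 *\<^sub>R y' - y) \<and>
    (gradient_sign s = -1 \<and> wb = gradient f z \<and> zb = 2 *\<^sub>R x' - x \<or>
     gradient_sign s = 1 \<and> wb = 2 *\<^sub>R gradient f z' - gradient f z \<and> zb = x)"

lemma generated_by_step:
  assumes "generated_by s f g h K \<eta>x \<eta>y \<eta>z x y z"
  obtains xb yb wb zb where
    "extrapolates s (x k) (y k) (z k) (x (Suc k)) (y (Suc k)) (z (Suc k)) xb yb wb zb"
    "x (Suc k) = prox (\<lambda>w. ereal \<eta>x * g w) (x k - \<eta>x *\<^sub>R adjoint K yb - \<eta>x *\<^sub>R wb)"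
    "y (Suc k) = prox (\<lambda>w. ereal \<eta>y * convex_conjugate h w) (y k + \<eta>y *\<^sub>R K xb)"
    "z (Suc k) = (1 / (1 + \<eta>z)) *\<^sub>R z k + (\<eta>z / (1 + \<eta>z)) *\<^sub>R zb"
proof (cases s)
  case ACV_I
  show thesis
    by (rule that[of "2 *\<^sub>R x (Suc k) - x k" "y k" "gradient f (z k)" "2 *\<^sub>R x (Suc k) - x k"])
      (use assms ACV_I in \<open>simp_all add: extrapolates_def\<close>)
next
  case ACV_II
  show thesis
    by (rule that[of "x k" "2 *\<^sub>R y (Suc k) - y k" "gradient f (z k)" "2 *\<^sub>R x (Suc k) - x k"])
      (use assms ACV_II in \<open>simp_all add: extrapolates_def\<close>)
next
  case APDTR_I
  show thesis
    by (rule that[of "2 *\<^sub>R x (Suc k) - x k" "y k"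
          "2 *\<^sub>R gradient f (z (Suc k)) - gradient f (z k)" "x k"])
      (use assms APDTR_I in \<open>simp_all add: extrapolates_def\<close>)
next
  case APDTR_II
  show thesis
    by (rule that[of "x k" "2 *\<^sub>R y (Suc k) - y k"
          "2 *\<^sub>R gradient f (z (Suc k)) - gradient f (z k)" "x k"])
      (use assms APDTR_II in \<open>simp_all add: extrapolates_def\<close>)
qed

lemma lyapunov_decrease:
  assumes ext: "extrapolates s x y z x' y' z' xb yb wb zb"
    and x': "x' = prox (\<lambda>w. ereal \<eta>x * g w) (x - \<eta>x *\<^sub>R adjoint K yb - \<eta>x *\<^sub>R wb)"
    and y': "y' = prox (\<lambda>w. ereal \<eta>y * hc w) (y + \<eta>y *\<^sub>R K xb)"
    and z': "z' = (1 / (1 + \<eta>z)) *\<^sub>R z + (\<eta>z / (1 + \<eta>z)) *\<^sub>R zb"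
  shows "\<Psi> s x' y' z' + \<mu> * (norm (x' - xs))\<^sup>2 + \<nu> * (norm (y' - ys))\<^sup>2 + bregman f z' xs
    + (norm (gradient f z' - gradient f xs))\<^sup>2 / (2 * L) \<le> \<Psi> s x y z"
proof -
  define X X' Y Y' where XY: "X = x - xs" "X' = x' - xs" "Y = y - ys" "Y' = y' - ys"
  define G G' where GG: "G = gradient f z - gradient f xs" "G' = gradient f z' - gradient f xs"
  \<comment> \<open>The subgradient at \<open>xs\<close> from \<open>primal_optimal\<close> serves
    as the one that \<open>prox_subgradient\<close> requires for its affine minorant.\<close>
  have "(1 / \<eta>x) *\<^sub>R ((x - \<eta>x *\<^sub>R adjoint K yb - \<eta>x *\<^sub>R wb) - x') \<in> subdifferential g x'"
    using convex_g primal_optimal steps_pos(1) x' unfolding strongly_convex_def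
    by (intro prox_subgradient) auto
  then have "\<mu> * (norm X')\<^sup>2
      \<le> ((1 / \<eta>x) *\<^sub>R ((x - \<eta>x *\<^sub>R adjoint K yb - \<eta>x *\<^sub>R wb) - x')
          - (- adjoint K ys - gradient f xs)) \<bullet> X'"
    unfolding XY by (rule strongly_convex_strongly_monotone[OF convex_g _ primal_optimal])
  also have "(1 / \<eta>x) *\<^sub>R ((x - \<eta>x *\<^sub>R adjoint K yb - \<eta>x *\<^sub>R wb) - x')
          - (- adjoint K ys - gradient f xs)
      = (1 / \<eta>x) *\<^sub>R (X - X') - (adjoint K yb - adjoint K ys) - (wb - gradient f xs)"
    using steps_pos(1) by (simp add: XY algebra_simps)
  also have "\<dots> \<bullet> X' = (X - X') \<bullet> X' / \<eta>x - (yb - ys) \<bullet> K X' - (wb - gradient f xs) \<bullet> X'"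
    by (simp add: inner_diff_left adjoint_K diff_divide_distrib)
  finally have hx: "\<mu> * (norm X')\<^sup>2
      \<le> ((norm X)\<^sup>2 - (norm X')\<^sup>2 - (norm (X' - X))\<^sup>2) / 2 / \<eta>x
        - (yb - ys) \<bullet> K X' - (wb - gradient f xs) \<bullet> X'"
    by (simp only: inner_decrement)
  have "(1 / \<eta>y) *\<^sub>R ((y + \<eta>y *\<^sub>R K xb) - y') \<in> subdifferential hc y'"
    using convex_hc dual_optimal steps_pos(2) y' unfolding strongly_convex_def
    by (intro prox_subgradient) auto
  then have "\<nu> * (norm Y')\<^sup>2 \<le> ((1 / \<eta>y) *\<^sub>R ((y + \<eta>y *\<^sub>R K xb) - y') - K xs) \<bullet> Y'"
    unfolding XY by (rule strongly_convex_strongly_monotone[OF convex_hc _ dual_optimal])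
  also have "(1 / \<eta>y) *\<^sub>R ((y + \<eta>y *\<^sub>R K xb) - y') - K xs = (1 / \<eta>y) *\<^sub>R (Y - Y') + K (xb - xs)"
    using steps_pos(2) by (simp add: XY algebra_simps K_simps)
  also have "\<dots> \<bullet> Y' = (Y - Y') \<bullet> Y' / \<eta>y + Y' \<bullet> K (xb - xs)"
    by (simp add: inner_add_left inner_commute[of Y'])
  finally have hy: "\<nu> * (norm Y')\<^sup>2
      \<le> ((norm Y)\<^sup>2 - (norm Y')\<^sup>2 - (norm (Y' - Y))\<^sup>2) / 2 / \<eta>y + Y' \<bullet> K (xb - xs)"
    by (simp only: inner_decrement)
  have hz: "bregman f z' xs / \<eta>z + bregman f z' xs + (norm G')\<^sup>2 / (2 * L)
      + (norm (G' - G))\<^sup>2 / (2 * (L * \<eta>z)) \<le> bregman f z xs / \<eta>z + G' \<bullet> (zb - xs)"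
    using bregman_step[OF z'] by (simp add: GG)
  \<comment> \<open>This identity fixes the sign in \<open>\<Psi>\<close>: extrapolating in the
    primal variable calls for -1, extrapolating in the dual one for +1, and in both cases only the
    product of increments remains.\<close>
  have c1: "coupling_sign s * (Y' \<bullet> K X') - coupling_sign s * (Y \<bullet> K X)
      + Y' \<bullet> K (xb - xs) - (yb - ys) \<bullet> K X' = - (coupling_sign s * ((Y' - Y) \<bullet> K (X' - X)))"
  proof -
    have "xb - xs = 2 *\<^sub>R X' - X \<and> yb - ys = Y \<and> coupling_sign s = -1 \<or>
        xb - xs = X \<and> yb - ys = 2 *\<^sub>R Y' - Y \<and> coupling_sign s = 1"
      using ext unfolding extrapolates_def
      by (elim conjE disjE) (simp_all add: XY scaleR_2 algebra_simps)
    then show ?thesis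
    proof (elim disjE conjE)
      assume eq: "xb - xs = 2 *\<^sub>R X' - X" "yb - ys = Y" "coupling_sign s = -1"
      show ?thesis
        unfolding eq by (simp add: K_simps inner_diff_left inner_diff_right)
    next
      assume eq: "xb - xs = X" "yb - ys = 2 *\<^sub>R Y' - Y" "coupling_sign s = 1"
      show ?thesis
        unfolding eq by (simp add: K_simps inner_diff_left inner_diff_right)
    qed
  qed
  \<comment> \<open>The same identity with the gradient difference \<open>G\<close> for
    \<open>Y\<close>, the identity for \<open>K\<close>, and \<open>zb\<close>, \<open>wb\<close> in
    the roles of \<open>xb\<close>, \<open>yb\<close>.\<close>
  have c2: "gradient_sign s * (G' \<bullet> X') - gradient_sign s * (G \<bullet> X)
      + G' \<bullet> (zb - xs) - (wb - gradient f xs) \<bullet> X' = - (gradient_sign s * ((G' - G) \<bullet> (X' - X)))"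
  proof -
    have "zb - xs = 2 *\<^sub>R X' - X \<and> wb - gradient f xs = G \<and> gradient_sign s = -1 \<or>
        zb - xs = X \<and> wb - gradient f xs = 2 *\<^sub>R G' - G \<and> gradient_sign s = 1"
      using ext unfolding extrapolates_def
      by (elim conjE disjE) (simp_all add: XY GG scaleR_2 algebra_simps)
    then show ?thesis
    proof (elim disjE conjE)
      assume eq: "zb - xs = 2 *\<^sub>R X' - X" "wb - gradient f xs = G" "gradient_sign s = -1"
      show ?thesis
        unfolding eq by (simp add: inner_diff_left inner_diff_right)
    next
      assume eq: "zb - xs = X" "wb - gradient f xs = 2 *\<^sub>R G' - G" "gradient_sign s = 1"
      show ?thesis
        unfolding eq by (simp add: inner_diff_left inner_diff_right)
    qed
  qed
  have b1: "- (coupling_sign s * ((Y' - Y) \<bullet> K (X' - X)))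
      \<le> (norm (Y' - Y))\<^sup>2 / (2 * \<eta>y) + (norm (X' - X))\<^sup>2 / (4 * \<eta>x)"
    using coupling_le[of "Y' - Y" "X' - X"] coupling_signs(1)[of s "(Y' - Y) \<bullet> K (X' - X)"]
    by linarith
  have b2: "- (gradient_sign s * ((G' - G) \<bullet> (X' - X)))
      \<le> (norm (G' - G))\<^sup>2 / (2 * (L * \<eta>z)) + (norm (X' - X))\<^sup>2 / (4 * \<eta>x)"
    using gradient_coupling_le[of "G' - G" "X' - X"]
      coupling_signs(2)[of s "(G' - G) \<bullet> (X' - X)"]
    by linarith
  have \<Psi>: "\<Psi> s x y z = (norm X)\<^sup>2 / (2 * \<eta>x) + (norm Y)\<^sup>2 / (2 * \<eta>y) + bregman f z xs / \<eta>z
      + coupling_sign s * (Y \<bullet> K X) + gradient_sign s * (G \<bullet> X)"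
    and \<Psi>': "\<Psi> s x' y' z' = (norm X')\<^sup>2 / (2 * \<eta>x) + (norm Y')\<^sup>2 / (2 * \<eta>y) + bregman f z' xs / \<eta>z
      + coupling_sign s * (Y' \<bullet> K X') + gradient_sign s * (G' \<bullet> X')"
    by (simp_all add: lyapunov_def XY GG)
  \<comment> \<open>The squared primal increment is split into two equal shares, one for
    \<open>b1\<close> and one for \<open>b2\<close>. The dual increment in \<open>q2\<close> pays
    the rest of \<open>b1\<close>, the gradient increment in \<open>hz\<close> the rest of
    \<open>b2\<close>.\<close>
  have q1: "((norm X)\<^sup>2 - (norm X')\<^sup>2 - (norm (X' - X))\<^sup>2) / 2 / \<eta>x
      = (norm X)\<^sup>2 / (2 * \<eta>x) - (norm X')\<^sup>2 / (2 * \<eta>x) - 2 * ((norm (X' - X))\<^sup>2 / (4 * \<eta>x))"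
    and q2: "((norm Y)\<^sup>2 - (norm Y')\<^sup>2 - (norm (Y' - Y))\<^sup>2) / 2 / \<eta>y
      = (norm Y)\<^sup>2 / (2 * \<eta>y) - (norm Y')\<^sup>2 / (2 * \<eta>y) - (norm (Y' - Y))\<^sup>2 / (2 * \<eta>y)"
    by (simp_all add: diff_divide_distrib)
  show ?thesis
    using hx hy hz c1 c2 b1 b2 unfolding \<Psi> \<Psi>' q1 q2 XY[symmetric] GG[symmetric] by linarith
qed

text \<open>By \<open>lyapunov_le\<close>, the new value of \<open>\<Psi>\<close> is at most
  \<open>c\<close> times the gain in \<open>lyapunov_decrease\<close>, hence at most
  \<open>c\<close> times the drop of \<open>\<Psi>\<close>.\<close>

lemma lyapunov_contraction:
  assumes step: "extrapolates s x y z x' y' z' xb yb wb zb"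
      "x' = prox (\<lambda>w. ereal \<eta>x * g w) (x - \<eta>x *\<^sub>R adjoint K yb - \<eta>x *\<^sub>R wb)"
      "y' = prox (\<lambda>w. ereal \<eta>y * hc w) (y + \<eta>y *\<^sub>R K xb)"
      "z' = (1 / (1 + \<eta>z)) *\<^sub>R z + (\<eta>z / (1 + \<eta>z)) *\<^sub>R zb"
    and c: "1 \<le> c * (\<mu> * \<eta>x)" "1 \<le> c * (\<nu> * \<eta>y)" "1 \<le> c * \<eta>z" and "c > 0"
  shows "\<Psi> s x' y' z' \<le> c / (c + 1) * \<Psi> s x y z"
proof -
  define G where "G = gradient f z' - gradient f xs"
  have "1 / \<eta>x \<le> c * \<mu>" "1 / \<eta>y \<le> c * \<nu>" "1 / \<eta>z \<le> c"
    using c steps_pos by (simp_all add: field_simps)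
  \<comment> \<open>The bound on \<open>1 / \<eta>z\<close> is used twice, for the Bregman distance
    and for the gradient square.\<close>
  note this[THEN mult_right_mono]
  note le = this(1)[of "(norm (x' - xs))\<^sup>2"] this(2)[of "(norm (y' - ys))\<^sup>2"]
    this(3)[of "bregman f z' xs"] this(3)[of "(norm G)\<^sup>2 / (2 * L)"]
  have B: "0 \<le> (norm G)\<^sup>2 / (2 * L)" "0 \<le> bregman f z' xs"
    using L_pos order_trans[OF _ bregman_ge, of 0] by simp_all
  have "\<Psi> s x' y' z' \<le> c * (\<mu> * (norm (x' - xs))\<^sup>2 + \<nu> * (norm (y' - ys))\<^sup>2 + bregman f z' xs
      + (norm G)\<^sup>2 / (2 * L))"
    using lyapunov_le[of s x' y' z'] le B by (simp add: G_def algebra_simps)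
  also have "\<dots> \<le> c * (\<Psi> s x y z - \<Psi> s x' y' z')"
    using lyapunov_decrease[OF step] \<open>c > 0\<close> by (intro mult_left_mono) (auto simp: G_def)
  finally have "\<Psi> s x' y' z' * (c + 1) \<le> c * \<Psi> s x y z"
    by (simp add: algebra_simps)
  then show ?thesis using \<open>c > 0\<close> by (simp add: field_simps)
qed

end

section \<open>Iteration complexity\<close>

text \<open>The factor is \<open>1 - 1 / (2 * \<kappa> + 1)\<close>, and
  \<open>2 * \<kappa> + 1 \<le> 3 * max 1 \<kappa>\<close> bounds it by
  \<open>exp (- 1 / (3 * max 1 \<kappa>))\<close>. This is the origin of the constant 3;
  \<open>\<epsilon> \<ge> 1\<close> requires no separate case.\<close>

lemma geometric_decay_iterations:
  fixes \<Phi> :: "nat \<Rightarrow> real" and \<kappa> :: real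
  assumes \<kappa>: "\<kappa> > 0" and nonneg: "\<Phi> 0 \<ge> 0"
    and step: "\<And>k. \<Phi> (Suc k) \<le> 2 * \<kappa> / (2 * \<kappa> + 1) * \<Phi> k"
    and \<epsilon>: "\<epsilon> > 0" and k: "real k \<ge> 3 * max 1 \<kappa> * ln (1 / \<epsilon>)"
  shows "\<Phi> k \<le> \<epsilon> * \<Phi> 0"
proof -
  define q where "q = 2 * \<kappa> / (2 * \<kappa> + 1)"
  define M where "M = max 1 \<kappa>"
  have q0: "0 \<le> q" using \<kappa> by (simp add: q_def)
  have "\<Phi> j \<le> q ^ j * \<Phi> 0" for j
  proof (induction j)
    case (Suc j)
    have "\<Phi> (Suc j) \<le> q * \<Phi> j" using step by (simp add: q_def)
    also have "\<dots> \<le> q * (q ^ j * \<Phi> 0)" using Suc q0 by (rule mult_left_mono)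
    finally show ?case by (simp add: mult_ac)
  qed simp
  moreover have "q ^ k \<le> \<epsilon>"
  proof -
    have "1 / (3 * M) \<le> 1 / (2 * \<kappa> + 1)"
      using \<kappa> by (intro divide_left_mono) (auto simp: M_def)
    moreover have "q = 1 - 1 / (2 * \<kappa> + 1)"
      using \<kappa> by (simp add: q_def field_simps)
    ultimately have "q \<le> exp (- 1 / (3 * M))"
      using exp_ge_add_one_self[of "- 1 / (3 * M)"] by simp
    then have "q ^ k \<le> exp (- 1 / (3 * M)) ^ k"
      using q0 by (rule power_mono)
    also have "\<dots> = exp (- (real k / (3 * M)))"
      by (simp add: exp_of_nat_mult[symmetric])
    also have "\<dots> \<le> exp (- ln (1 / \<epsilon>))"
    proof -
      have "M > 0" by (simp add: M_def)
      then show ?thesis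
        using k unfolding M_def[symmetric] by (simp add: pos_le_divide_eq mult.commute)
    qed
    also have "\<dots> = \<epsilon>" using \<epsilon> by (simp add: ln_div)
    finally show ?thesis .
  qed
  ultimately show ?thesis
    using nonneg mult_right_mono order_trans by metis
qed

lemma optimality_triple_iff:
  "optimality_triple f g h K x y z \<longleftrightarrow>
    - adjoint K y - gradient f x \<in> subdifferential g x \<and>
    K x \<in> subdifferential (convex_conjugate h) y \<and> z = x"
proof -
  have "0 = p + adjoint K y + gradient f z \<longleftrightarrow> p = - adjoint K y - gradient f z" for p
    using eq_neg_iff_add_eq_0[of p "adjoint K y + gradient f z"]
    unfolding eq_commute[of 0] by (simp add: add.assoc)
  then show ?thesis
    by (auto simp: optimality_triple_def image_iff)
qed

theorem corollary2:
  fixes f :: "real ^ 'n \<Rightarrow> real"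
    and g :: "real ^ 'n \<Rightarrow> ereal"
    and h :: "real ^ 'm \<Rightarrow> ereal"
    and K :: "real ^ 'n \<Rightarrow> real ^ 'm"
    and L \<mu> \<nu> \<eta>x \<eta>y \<eta>z :: real
    and xs zs :: "real ^ 'n"
    and ys :: "real ^ 'm"
  assumes "convex_on UNIV f" and "smooth_fun L f" and "L > 0"
    and "proper_fun g" and "closed_fun g" and "strongly_convex \<mu> g" and "\<mu> > 0"
    and "proper_fun h" and "closed_fun h" and "convex_fun h"
    and "strongly_convex \<nu> (convex_conjugate h)" and "\<nu> > 0"
    and "linear K" and "K \<noteq> (\<lambda>x. 0)"
    and "optimality_triple f g h K xs ys zs"
    and "\<eta>x = min (1 / sqrt (L * \<mu>)) (sqrt (\<nu> / ((onorm K)\<^sup>2 * \<mu>)))"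
    and "\<eta>y = 1 / 2 * sqrt (\<mu> / ((onorm K)\<^sup>2 * \<nu>))"
    and "\<eta>z = 1 / 2 * sqrt (\<mu> / L)"
  shows "(\<forall>x y z. optimality_triple f g h K x y z \<longrightarrow> x = xs \<and> y = ys \<and> z = zs) \<and>
    (\<forall>s x y z. generated_by s f g h K \<eta>x \<eta>y \<eta>z x y z \<longrightarrow>
      (let \<Psi> = (\<lambda>k::nat. lyapunov s f K \<eta>x \<eta>y \<eta>z xs ys zs (x k) (y k) (z k)) in
        \<forall>\<epsilon>>0. \<forall>k.
          real k \<ge> 3 * max 1 (condition_number L \<mu> \<nu> (onorm K)) * ln (1 / \<epsilon>) \<longrightarrow>
          \<Psi> k \<le> \<epsilon> * \<Psi> 0))"
proof -
  define n where "n = onorm K"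
  define \<kappa> where "\<kappa> = condition_number L \<mu> \<nu> n"
  have bl: "bounded_linear K" using \<open>linear K\<close> by (simp add: linear_conv_bounded_linear)
  have opt: "- adjoint K ys - gradient f xs \<in> subdifferential g xs"
      "K xs \<in> subdifferential (convex_conjugate h) ys" "zs = xs"
    using assms(15) by (simp_all add: optimality_triple_iff)
  interpret saddle_point f g "convex_conjugate h" K L \<mu> \<nu> xs ys
    by (intro saddle_point.intro assms opt)
  \<comment> \<open>In terms of square roots, the step sizes and \<open>\<kappa>\<close> are built
    from quotients alone. Since \<open>K\<close> is nonzero, \<open>n\<close> is positive and the
    quotients are genuine.\<close>
  define a m v where am: "a = sqrt L" "m = sqrt \<mu>" "v = sqrt \<nu>"
  have pos: "a > 0" "m > 0" "v > 0" "n > 0"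
    using L_pos \<mu>_pos \<nu>_pos assms(14) by (auto simp: am n_def onorm_pos_lt[OF bl])
  have sq: "L = a\<^sup>2" "\<mu> = m\<^sup>2" "\<nu> = v\<^sup>2"
    using L_pos \<mu>_pos \<nu>_pos by (simp_all add: am)
  have \<eta>x: "\<eta>x = min (1 / (a * m)) (v / (n * m))"
    and \<eta>y: "\<eta>y = m / (2 * n * v)" and \<eta>z: "\<eta>z = m / (2 * a)"
    and \<kappa>: "\<kappa> = a / m + n / (m * v)"
    using pos unfolding assms(16-18) \<kappa>_def condition_number_def n_def[symmetric] sq
    by (simp_all add: real_sqrt_mult real_sqrt_divide)
  have \<eta>x_le: "\<eta>x \<le> 1 / (a * m)" "\<eta>x \<le> v / (n * m)" by (simp_all add: \<eta>x)
  have \<eta>pos: "\<eta>x > 0" "\<eta>y > 0" "\<eta>z > 0" using pos by (simp_all add: \<eta>x \<eta>y \<eta>z)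
  interpret saddle_point_steps f g "convex_conjugate h" K L \<mu> \<nu> xs ys \<eta>x \<eta>y \<eta>z
  proof unfold_locales
    \<comment> \<open>Each entry of the minimum defining \<open>\<eta>x\<close> secures one of the
      two conditions, with equality at that entry.\<close>
    have "n\<^sup>2 * \<eta>x * \<eta>y \<le> n\<^sup>2 * (v / (n * m)) * \<eta>y"
      using \<eta>x_le(2) \<eta>pos by (intro mult_right_mono mult_left_mono) auto
    also have "\<dots> = 1 / 2" using pos by (simp add: \<eta>y field_simps power2_eq_square)
    finally show "(onorm K)\<^sup>2 * \<eta>x * \<eta>y \<le> 1 / 2" by (simp add: n_def)
    have "L * \<eta>x * \<eta>z \<le> L * (1 / (a * m)) * \<eta>z"
      using \<eta>x_le(1) \<eta>pos L_pos by (intro mult_right_mono mult_left_mono) auto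
    also have "\<dots> = 1 / 2" using pos by (simp add: sq \<eta>z field_simps power2_eq_square)
    finally show "L * \<eta>x * \<eta>z \<le> 1 / 2" .
  qed (use \<eta>pos in auto)
  have \<kappa>_ge: "\<kappa> \<ge> a / m" "\<kappa> \<ge> n / (m * v)" using pos by (simp_all add: \<kappa>)
  then have \<kappa>_pos: "\<kappa> > 0" using pos by (smt (verit) divide_pos_pos)
  \<comment> \<open>The factor 2 compensates the factor 1/2 in \<open>\<eta>y\<close> and
    \<open>\<eta>z\<close>; for \<open>\<eta>x\<close>, already \<open>\<kappa>\<close>
    suffices.\<close>
  have rate: "1 \<le> 2 * \<kappa> * (\<mu> * \<eta>x)" "1 \<le> 2 * \<kappa> * (\<nu> * \<eta>y)" "1 \<le> 2 * \<kappa> * \<eta>z"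
  proof -
    have "1 \<le> \<kappa> * (\<mu> * (1 / (a * m)))" "1 \<le> \<kappa> * (\<mu> * (v / (n * m)))"
      using \<kappa>_ge pos by (simp_all add: sq field_simps power2_eq_square)
    then have "1 \<le> \<kappa> * (\<mu> * \<eta>x)" by (simp add: \<eta>x min_def)
    then show "1 \<le> 2 * \<kappa> * (\<mu> * \<eta>x)" by simp
    show "1 \<le> 2 * \<kappa> * (\<nu> * \<eta>y)" "1 \<le> 2 * \<kappa> * \<eta>z"
      using \<kappa>_ge pos by (simp_all add: sq \<eta>y \<eta>z field_simps power2_eq_square)
  qed
  show ?thesis
  proof (intro conjI allI impI)
    fix x y z assume "optimality_triple f g h K x y z"
    then show "x = xs" "y = ys" "z = zs"
      using unique opt(3) by (auto simp: optimality_triple_iff)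
  next
    fix s x y z assume gen: "generated_by s f g h K \<eta>x \<eta>y \<eta>z x y z"
    have "\<Psi> s (x (Suc k)) (y (Suc k)) (z (Suc k))
        \<le> 2 * \<kappa> / (2 * \<kappa> + 1) * \<Psi> s (x k) (y k) (z k)" for k
      by (rule generated_by_step[OF gen, of k], rule lyapunov_contraction)
        (use rate \<kappa>_pos in auto)
    then show "let \<Psi> = (\<lambda>k. lyapunov s f K \<eta>x \<eta>y \<eta>z xs ys zs (x k) (y k) (z k)) in
        \<forall>\<epsilon>>0. \<forall>k. real k \<ge> 3 * max 1 (condition_number L \<mu> \<nu> (onorm K)) * ln (1 / \<epsilon>) \<longrightarrow>
          \<Psi> k \<le> \<epsilon> * \<Psi> 0"
      unfolding Let_def opt(3) n_def[symmetric] \<kappa>_def[symmetric]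
      using geometric_decay_iterations[where \<Phi> = "\<lambda>k. \<Psi> s (x k) (y k) (z k)",
          OF \<kappa>_pos lyapunov_nonneg] by blast
  qed
qed

end
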